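(* Let $d\ge 1$ and let $\Sigma_\mu,\Sigma_\nu\in\mathcal{S}_d^+$. Then there exists $(O,C)\in\mathcal{O}_d\times\mathfrak{C}_d$ such that $O^*\Sigma_\mu O$ and $O^*\Sigma_\nu O$ share the correlation matrix $C$. Besides, for any such couple $(O,C)$, the matrix $$\Theta=O\,\mathrm{dg}(O^*\Sigma_\mu O)^{1/2}\,C\,\mathrm{dg}(O^*\Sigma_\nu O)^{1/2}\,O^*$$ is optimal in the maximization problem defining $V(\Sigma_\mu,\Sigma_\nu)$ (i.e. $\Gamma_\Theta\in\mathcal{S}^+_{2d}$ and $\mathrm{tr}(\Theta)=V(\Sigma_\mu,\Sigma_\nu)$), and we have $$V(\Sigma_\mu,\Sigma_\nu)=\mathrm{tr}\left(O\,\mathrm{dg}(O^*\Sigma_\mu O)^{1/2}\,C\,\mathrm{dg}(O^*\Sigma_\nu O)^{1/2}\,O^*\right)=\sum_{i=1}^d\sqrt{(O^*\Sigma_\mu O)_{ii}(O^*\Sigma_\nu O)_{ii}}=\mathrm{tr}\left(\left(\Sigma_\mu^{1/2}\Sigma_\nu\Sigma_\mu^{1/2}\right)^{1/2}\right).$$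
   Context: $\mathcal{S}_d^+$ is the set of real symmetric positive semi-definite $d\times d$ matrices (possibly singular). $\mathcal{O}_d$ is the set of real orthogonal $d\times d$ matrices. $M^*$ denotes the transpose of $M$ and $\mathrm{tr}$ the trace. For $\Sigma\in\mathcal{S}_d^+$, $\Sigma^{1/2}$ is the unique element of $\mathcal{S}_d^+$ with $\Sigma^{1/2}\Sigma^{1/2}=\Sigma$, and $\mathrm{dg}(\Sigma)=\mathrm{diag}(\Sigma_{11},\dots,\Sigma_{dd})$ is the diagonal matrix with the same diagonal as $\Sigma$, so that $\mathrm{dg}(\Sigma)^{1/2}=\mathrm{diag}(\sqrt{\Sigma_{11}},\dots,\sqrt{\Sigma_{dd}})$. The set of correlation matrices is $\mathfrak{C}_d=\{C\in\mathcal{S}_d^+ : C_{ii}=1 \text{ for all } i\in\{1,\dots,d\}\}$. Two matrices $\Sigma_1,\Sigma_2\in\mathcal{S}_d^+$ are said to share the correlation matrix $C\in\mathfrak{C}_d$ if $\Sigma_i=\mathrm{dg}(\Sigma_i)^{1/2}\,C\,\mathrm{dg}(\Sigma_i)^{1/2}$ for $i\in\{1,2\}$. For $\Sigma_\mu,\Sigma_\nu\in\mathcal{S}_d^+$ and $\Theta\in\mathbb{R}^{d\times d}$, set $\Gamma_\Theta=\begin{pmatrix}\Sigma_\mu & \Theta\\ \Theta^* & \Sigma_\nu\end{pmatrix}\in\mathbb{R}^{2d\times 2d}$, and define $$V(\Sigma_\mu,\Sigma_\nu)=\sup\{\mathrm{tr}(\Theta) : \Theta\in\mathbb{R}^{d\times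 d},\ \Gamma_\Theta\in\mathcal{S}^+_{2d}\}.$$ *)

theory Defs
  imports "HOL-Analysis.Analysis"
begin

definition psd :: "real^'n^'n \<Rightarrow> bool" where
  "psd A \<longleftrightarrow> transpose A = A \<and> (\<forall>x. 0 \<le> x \<bullet> (A *v x))"

text \<open>Only meaningful for a positive semi-definite argument, where the root exists and is unique.\<close>

definition mat_sqrt :: "real^'n^'n \<Rightarrow> real^'n^'n" where
  "mat_sqrt A = (THE B. psd B \<and> B ** B = A)"

definition dg :: "real^'n^'n \<Rightarrow> real^'n^'n" where
  "dg A = (\<chi> i j. if i = j then A $ i $ i else 0)"

definition correlation_matrix :: "real^'n^'n \<Rightarrow> bool" where
  "correlation_matrix C \<longleftrightarrow> psd C \<and> (\<forall>i. C $ i $ i = 1)"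

definition share_correlation :: "real^'n^'n \<Rightarrow> real^'n^'n \<Rightarrow> real^'n^'n \<Rightarrow> bool" where
  "share_correlation A B C \<longleftrightarrow>
     A = mat_sqrt (dg A) ** C ** mat_sqrt (dg A) \<and>
     B = mat_sqrt (dg B) ** C ** mat_sqrt (dg B)"

text \<open>Block matrices of size \<open>2d\<close> are indexed by the sum type \<open>'n + 'n\<close>:
  \<open>Inl\<close> addresses the first block of indices and \<open>Inr\<close> the second.\<close>

definition block_cov :: "real^'n^'n \<Rightarrow> real^'n^'n \<Rightarrow> real^'n^'n \<Rightarrow> real^('n + 'n)^('n + 'n)" where
  "block_cov A B T = (\<chi> i j. case i of
       Inl a \<Rightarrow> (case j of Inl b \<Rightarrow> A $ a $ b | Inr b \<Rightarrow> T $ a $ b)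
     | Inr a \<Rightarrow> (case j of Inl b \<Rightarrow> transpose T $ a $ b | Inr b \<Rightarrow> B $ a $ b))"

text \<open>The supremum is taken in the extended reals, so that it is the true supremum
  without any boundedness proviso.\<close>

definition V :: "real^'n^'n \<Rightarrow> real^'n^'n \<Rightarrow> ereal" where
  "V A B = (SUP T \<in> {T. psd (block_cov A B T)}. ereal (trace T))"

definition optimal_coupling :: "real^'n^'n \<Rightarrow> real^'n^'n \<Rightarrow> real^'n^'n \<Rightarrow> bool" where
  "optimal_coupling A B T \<longleftrightarrow> psd (block_cov A B T) \<and> ereal (trace T) = V A B"

end

theory Submission
  imports Defs
begin

text \<open>
  Write \<open>A\<close>, \<open>B\<close> for the two covariance matrices. A column \<open>q\<close> of an orthogonal matrix \<open>Q\<close>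
  turns the positivity of the block matrix of a coupling \<open>T\<close> into the positivity of a
  \<open>2 \<times> 2\<close> form, so \<open>q \<bullet> T q \<le> sqrt ((q \<bullet> A q) (q \<bullet> B q))\<close>. Summing over the columns bounds
  \<open>trace T\<close>, for every orthogonal \<open>Q\<close>, by the sum in the theorem (\<open>trace_coupling_le\<close>).
  If in the basis \<open>Q\<close> the two matrices are \<open>D C D\<close> and \<open>E C E\<close> with \<open>D\<close>, \<open>E\<close> diagonal, then
  \<open>Q D C E Q\<^sup>T\<close> is a coupling (the one with correlation 1 between corresponding normalised
  coordinates), because the block form at \<open>(u, v)\<close> is the form of \<open>C\<close> at \<open>D Q\<^sup>T u + E Q\<^sup>T v\<close>
  (\<open>diag_congruence_block_cov\<close>). Its trace attains the bound since \<open>C\<close> has unit diagonal.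

  Such a pair \<open>(Q, C)\<close> is explicit when \<open>A\<close> is positive definite: the symmetric matrix
  \<open>T = A\<^sup>-\<^sup>1\<^sup>/\<^sup>2 (A\<^sup>1\<^sup>/\<^sup>2 B A\<^sup>1\<^sup>/\<^sup>2)\<^sup>1\<^sup>/\<^sup>2 A\<^sup>-\<^sup>1\<^sup>/\<^sup>2\<close> of the optimal transport map satisfies \<open>T A T = B\<close>,
  so in an eigenbasis of \<open>T\<close> passing from \<open>A\<close> to \<open>B\<close> merely rescales the coordinates by
  nonnegative factors, which does not change correlations
  (\<open>positive_definite_common_correlation\<close>). A singular \<open>A\<close> is the limit of
  \<open>A + \<epsilon> I\<close>; orthogonal matrices and correlation matrices form compact sets, and the
  identities expressing a shared correlation are closed (\<open>common_correlation_exists\<close>).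

  For the last formula, put \<open>G = C\<^sup>1\<^sup>/\<^sup>2\<close> and \<open>W = G E Q\<^sup>T A\<^sup>1\<^sup>/\<^sup>2\<close>. Then \<open>W\<^sup>T W\<close> is
  \<open>A\<^sup>1\<^sup>/\<^sup>2 B A\<^sup>1\<^sup>/\<^sup>2\<close>, while \<open>W W\<^sup>T\<close> is the square of \<open>G D E G\<close>, whose trace is that of \<open>D E C\<close>.
  The square roots of \<open>W\<^sup>T W\<close> and \<open>W W\<^sup>T\<close> have the same trace (\<open>trace_abs_transpose\<close>), the sum of
  the singular values of \<open>W\<close>.
\<close>

section \<open>Spectral theorem for real symmetric matrices\<close>

lemma symmetric_inner:
  fixes A :: "real^'n^'n"
  assumes "transpose A = A"
  shows "(A *v x) \<bullet> y = x \<bullet> (A *v y)"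
  by (metis assms dot_lmul_matrix transpose_matrix_vector)

text \<open>
  A maximiser \<open>v\<close> of the Rayleigh quotient on the unit sphere of an invariant subspace is an
  eigenvector. With the maximum \<open>l\<close>, the form \<open>q x = l (x \<bullet> x) - x \<bullet> A x\<close> is nonnegative on
  the subspace and vanishes at \<open>v\<close>, so its derivative at \<open>v\<close> in the direction of the residual
  \<open>w = l v - A v\<close> must vanish; that derivative is \<open>2 (w \<bullet> w)\<close>.
\<close>

lemma symmetric_eigenvector:
  fixes A :: "real^'n^'n"
  assumes sym: "transpose A = A" and S: "subspace S" and inv: "\<And>x. x \<in> S \<Longrightarrow> A *v x \<in> S"
    and y: "y \<in> S" "y \<noteq> 0"
  shows "\<exists>v\<in>S. norm v = 1 \<and> (\<exists>l. A *v v = l *\<^sub>R v)"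
proof -
  have "compact (S \<inter> sphere 0 1)"
    using closed_subspace[OF S] by (simp add: compact_Int_closed Int_commute closed_Int_compact)
  moreover have "(1 / norm y) *\<^sub>R y \<in> S \<inter> sphere 0 1"
    using y S by (auto simp: subspace_scale)
  moreover have "continuous_on (S \<inter> sphere 0 1) (\<lambda>x. x \<bullet> (A *v x))"
    by (intro continuous_intros linear_continuous_on linear_linear[THEN iffD2] matrix_vector_mul_linear)
  ultimately have "\<exists>v\<in>S \<inter> sphere 0 1. \<forall>x\<in>S \<inter> sphere 0 1. x \<bullet> (A *v x) \<le> v \<bullet> (A *v v)"
    by (intro continuous_attains_sup) blast+
  then obtain v where v: "v \<in> S" "norm v = 1"
    and max: "\<And>x. x \<in> S \<Longrightarrow> norm x = 1 \<Longrightarrow> x \<bullet> (A *v x) \<le> v \<bullet> (A *v v)"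
    by auto
  define l where "l = v \<bullet> (A *v v)"
  define q where "q x = l * (x \<bullet> x) - x \<bullet> (A *v x)" for x
  have q_nonneg: "0 \<le> q x" if "x \<in> S" for x
  proof (cases "x = 0")
    case False
    have "((1 / norm x) *\<^sub>R x) \<bullet> (A *v ((1 / norm x) *\<^sub>R x)) \<le> l"
      unfolding l_def using that False S by (intro max) (auto simp: subspace_scale)
    then have "(x \<bullet> (A *v x)) / (norm x)\<^sup>2 \<le> l"
      by (simp add: matrix_vector_mult_scaleR power2_eq_square)
    then show ?thesis
      using False by (simp add: q_def pos_divide_le_eq power2_norm_eq_inner)
  qed (simp add: q_def)
  define w where "w = l *\<^sub>R v - A *v v"
  have w: "w \<in> S"
    unfolding w_def using S v inv by (simp add: subspace_diff subspace_scale)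
  have q_v: "q v = 0"
    using v by (simp add: q_def l_def power2_norm_eq_inner[symmetric])
  have q_expand: "q (v + t *\<^sub>R w) = 2 * t * (w \<bullet> w) + t\<^sup>2 * q w" for t
  proof -
    have "q (v + t *\<^sub>R w) = q v + 2 * t * (w \<bullet> (l *\<^sub>R v - A *v v)) + t\<^sup>2 * q w"
      using symmetric_inner[OF sym, of v w]
      by (simp add: q_def algebra_simps matrix_vector_right_distrib matrix_vector_mult_scaleR
          inner_commute power2_eq_square)
    then show ?thesis by (simp add: q_v w_def)
  qed
  have "w = 0"
  proof (rule ccontr)
    assume "w \<noteq> 0"
    then have c: "0 < w \<bullet> w" by simp
    \<comment> \<open>A step against the slope, short enough for the linear term to dominate the quadratic one;
      the 1 covers the case \<open>q w = 0\<close>.\<close>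
    define t where "t = - (w \<bullet> w) / (1 + q w)"
    have "0 \<le> q (v + t *\<^sub>R w)"
      using S v w by (intro q_nonneg) (simp add: subspace_add subspace_scale)
    then have "0 \<le> 2 * t * (w \<bullet> w) + t\<^sup>2 * q w" by (simp add: q_expand)
    moreover have "2 * t * (w \<bullet> w) + t\<^sup>2 * q w = - ((w \<bullet> w)\<^sup>2 * (2 + q w)) / (1 + q w)\<^sup>2"
      using q_nonneg[OF w] by (simp add: t_def divide_simps) (simp add: algebra_simps power2_eq_square)
    moreover have "\<dots> < 0"
      using c q_nonneg[OF w] by (simp add: divide_neg_pos)
    ultimately show False by linarith
  qed
  then have "A *v v = l *\<^sub>R v" by (simp add: w_def)
  then show ?thesis using v by blast
qed

text \<open>
  The orthogonal complement of a set of eigenvectors is invariant, by symmetry, so as long as it is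
  not trivial it contributes a further eigenvector.
\<close>

lemma orthonormal_eigenvectors:
  fixes A :: "real^'n^'n"
  assumes sym: "transpose A = A"
  shows "k \<le> CARD('n) \<Longrightarrow> \<exists>B. finite B \<and> card B = k \<and> pairwise orthogonal B \<and>
    (\<forall>v\<in>B. norm v = 1 \<and> (\<exists>l. A *v v = l *\<^sub>R v))"
proof (induction k)
  case 0
  show ?case by (rule exI[of _ "{}"]) (simp add: pairwise_def)
next
  case (Suc k)
  then obtain B where B: "finite B" "card B = k" "pairwise orthogonal B"
    and eig: "\<forall>v\<in>B. norm v = 1 \<and> (\<exists>l. A *v v = l *\<^sub>R v)" by auto
  define S where "S = {x. \<forall>b\<in>B. b \<bullet> x = 0}"
  have S: "subspace S" by (auto simp: S_def subspace_def inner_right_distrib)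
  have inv: "A *v x \<in> S" if "x \<in> S" for x
    unfolding S_def
  proof safe
    fix b assume b: "b \<in> B"
    then obtain l where "A *v b = l *\<^sub>R b" using eig by auto
    then show "b \<bullet> (A *v x) = 0"
      using symmetric_inner[OF sym, of b x] that b by (simp add: S_def)
  qed
  have "dim B < DIM(real^'n)"
    using dim_le_card'[OF B(1)] B(2) Suc.prems by simp
  then obtain y where "y \<noteq> 0" "\<And>z. z \<in> span B \<Longrightarrow> orthogonal y z"
    using orthogonal_to_subspace_exists by metis
  then have "y \<in> S" "y \<noteq> 0"
    by (auto simp: S_def orthogonal_def span_base inner_commute)
  then obtain v where v: "v \<in> S" "norm v = 1" "\<exists>l. A *v v = l *\<^sub>R v"
    using symmetric_eigenvector[OF sym S inv] by blast
  then have "v \<notin> B" unfolding S_def by (auto simp: norm_eq_1)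
  moreover have "pairwise orthogonal (insert v B)"
    using B v(1) by (auto simp: pairwise_insert orthogonal_def S_def inner_commute)
  ultimately show ?case
    using B eig v by (intro exI[of _ "insert v B"]) simp
qed

definition diag :: "('n \<Rightarrow> real) \<Rightarrow> real^'n^'n" where
  "diag a = (\<chi> i j. if i = j then a i else 0)"

lemma diag_nth [simp]: "diag a $ i $ j = (if i = j then a i else 0)"
  by (simp add: diag_def)

lemma diag_mult_nth [simp]: "(diag a ** A) $ i $ j = a i * A $ i $ j"
  by (simp add: matrix_matrix_mult_def if_distrib[of "\<lambda>x. x * _"] cong: if_cong)

lemma mult_diag_nth [simp]: "(A ** diag a) $ i $ j = A $ i $ j * a j"
  by (simp add: matrix_matrix_mult_def if_distrib[of "\<lambda>x. _ * x"] cong: if_cong)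

lemma transpose_diag [simp]: "transpose (diag a) = diag a"
  by (auto simp: vec_eq_iff transpose_def)

lemma diag_mult_diag: "diag a ** diag b = diag (\<lambda>i. a i * b i)"
  by (auto simp: vec_eq_iff)

lemma diag_mult_vec: "diag a *v x = (\<chi> i. a i * x $ i)"
  by (simp add: vec_eq_iff matrix_vector_mult_def if_distrib[of "\<lambda>x. x * _"] cong: if_cong)

lemma orthogonal_matrix_mult_transpose:
  "orthogonal_matrix Q \<Longrightarrow> Q ** transpose Q = mat 1"
  "orthogonal_matrix Q \<Longrightarrow> transpose Q ** Q = mat 1"
  by (auto simp: orthogonal_matrix_def)

text \<open>
  Entries in the rotated basis are values of the bilinear form at the columns of \<open>Q\<close>.
\<close>

lemma transpose_mult_mult_nth:
  "(transpose Q ** A ** Q) $ i $ j = column i Q \<bullet> (A *v column j Q)"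
proof -
  have "(transpose Q ** A ** Q) $ i $ j = (transpose Q ** (A ** Q)) $ i $ j"
    by (simp add: matrix_mul_assoc)
  then show ?thesis
    by (simp add: inner_vec_def matrix_matrix_mult_def matrix_vector_mult_def column_def transpose_def)
qed

lemma spectral_decomposition:
  fixes A :: "real^'n^'n"
  assumes sym: "transpose A = A"
  obtains Q a where "orthogonal_matrix Q" "A = Q ** diag a ** transpose Q"
proof -
  obtain B where B: "finite B" "card B = CARD('n)" "pairwise orthogonal B"
    and eig: "\<forall>v\<in>B. norm v = 1 \<and> (\<exists>l. A *v v = l *\<^sub>R v)"
    using orthonormal_eigenvectors[OF sym order_refl] by blast
  obtain f :: "'n \<Rightarrow> real^'n" where f: "bij_betw f UNIV B"
    using B finite_same_card_bij[of "UNIV::'n set" B] by auto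
  have fB: "f i \<in> B" for i using f by (auto simp: bij_betw_def)
  have "\<forall>i. \<exists>l. A *v f i = l *\<^sub>R f i" using eig fB by blast
  then obtain a where a: "\<And>i. A *v f i = a i *\<^sub>R f i" by metis
  define Q where "Q = (\<chi> i j. f j $ i)"
  have col: "column j Q = f j" for j by (simp add: Q_def column_def vec_eq_iff)
  have orth: "norm (f i) = 1" "i \<noteq> j \<Longrightarrow> f i \<bullet> f j = 0" for i j
  proof -
    show "norm (f i) = 1" using eig fB by blast
    assume "i \<noteq> j"
    then have "f i \<noteq> f j" using f by (auto simp: bij_betw_def inj_on_def)
    then show "f i \<bullet> f j = 0" using B(3) fB by (auto simp: pairwise_def orthogonal_def)
  qed
  then have Q: "orthogonal_matrix Q"
    by (auto simp: orthogonal_matrix_orthonormal_columns orthogonal_def col)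
  have ent: "(transpose Q ** A ** Q) $ i $ j = diag a $ i $ j" for i j
    using orth(1)[of i] orth(2)[of i j] unfolding transpose_mult_mult_nth col
    by (cases "i = j") (auto simp: a norm_eq_1)
  have "transpose Q ** A ** Q = diag a"
    unfolding vec_eq_iff using ent by simp
  moreover have "Q ** (transpose Q ** A ** Q) ** transpose Q = (Q ** transpose Q) ** A ** (Q ** transpose Q)"
    by (simp only: matrix_mul_assoc)
  ultimately have "A = Q ** diag a ** transpose Q"
    by (simp add: orthogonal_matrix_mult_transpose[OF Q])
  with Q show ?thesis by (rule that)
qed

section \<open>Positive semi-definite matrices and their square roots\<close>

lemma psd_congruence:
  fixes A Q :: "real^'n^'n"
  assumes "psd A"
  shows "psd (transpose Q ** A ** Q)"
proof -
  have "x \<bullet> ((transpose Q ** A ** Q) *v x) = (Q *v x) \<bullet> (A *v (Q *v x))" for x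
    by (simp only: matrix_vector_mul_assoc[symmetric] inner_commute[of x] transpose_matrix_vector dot_lmul_matrix)
      (simp only: inner_commute)
  then show ?thesis
    using assms by (simp add: psd_def matrix_transpose_mul matrix_mul_assoc)
qed

lemma psd_nth_nonneg: "psd A \<Longrightarrow> 0 \<le> A $ i $ i"
proof -
  assume "psd A"
  then have "0 \<le> axis i 1 \<bullet> (A *v axis i 1)" by (simp add: psd_def)
  then show ?thesis by (simp add: matrix_vector_mult_basis inner_axis' column_def)
qed

lemma psd_diag: "psd (diag a) \<longleftrightarrow> (\<forall>i. 0 \<le> a i)"
proof
  assume "psd (diag a)" then show "\<forall>i. 0 \<le> a i" using psd_nth_nonneg by force
next
  assume "\<forall>i. 0 \<le> a i"
  then have "0 \<le> x $ i * (a i * x $ i)" for x i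
    using mult_nonneg_nonneg[of "a i" "x $ i * x $ i"] by (simp add: mult_ac)
  then show "psd (diag a)"
    by (auto simp: psd_def diag_mult_vec inner_vec_def intro!: sum_nonneg)
qed

lemma psd_spectral_decomposition:
  fixes A :: "real^'n^'n"
  assumes "psd A"
  obtains Q a where "orthogonal_matrix Q" "A = Q ** diag a ** transpose Q" "\<And>i. 0 \<le> a i"
proof -
  obtain Q a where Q: "orthogonal_matrix Q" "A = Q ** diag a ** transpose Q"
    using assms spectral_decomposition[of A] unfolding psd_def by blast
  have "transpose Q ** A ** Q = (transpose Q ** Q) ** diag a ** (transpose Q ** Q)"
    unfolding Q(2) by (simp only: matrix_mul_assoc)
  then have "transpose Q ** A ** Q = diag a"
    by (simp add: orthogonal_matrix_mult_transpose[OF Q(1)])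
  then have "psd (diag a)" using psd_congruence[OF assms, of Q] by simp
  with Q show ?thesis using that by (simp add: psd_diag)
qed

lemma spectral_eigen_equations:
  fixes A Q :: "real^'n^'n"
  assumes Q: "orthogonal_matrix Q" and A: "A = Q ** diag a ** transpose Q"
  shows "A ** Q = Q ** diag a" "transpose Q ** A = diag a ** transpose Q" "trace A = sum a UNIV"
proof -
  have "A ** Q = Q ** diag a ** (transpose Q ** Q)"
    unfolding A by (simp only: matrix_mul_assoc)
  then show "A ** Q = Q ** diag a"
    by (simp add: orthogonal_matrix_mult_transpose[OF Q])
  have "transpose Q ** A = (transpose Q ** Q) ** diag a ** transpose Q"
    unfolding A by (simp only: matrix_mul_assoc)
  then show "transpose Q ** A = diag a ** transpose Q"
    by (simp add: orthogonal_matrix_mult_transpose[OF Q])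
  have "trace A = trace (diag a ** (transpose Q ** Q))"
    unfolding A matrix_mul_assoc[symmetric] by (subst trace_mul_sym) (simp only: matrix_mul_assoc)
  then show "trace A = sum a UNIV"
    by (simp add: orthogonal_matrix_mult_transpose[OF Q] trace_def)
qed

text \<open>
  In eigenbases of \<open>R\<close> and \<open>S\<close>, an entry \<open>w\<close> of the intertwiner satisfies \<open>r\<^sup>2 w = w s\<^sup>2\<close>, and
  nonnegative eigenvalues with equal squares are equal. With \<open>W\<close> the identity this is the
  uniqueness of the square root; for general \<open>W\<close> it compares the square roots of \<open>W W\<^sup>T\<close> and \<open>W\<^sup>T W\<close>.
\<close>

lemma psd_intertwine_squares:
  fixes R S W :: "real^'n^'n"
  assumes "psd R" "psd S" and eq: "(R ** R) ** W = W ** (S ** S)"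
  shows "R ** W = W ** S"
proof -
  obtain P r where P: "orthogonal_matrix P" "R = P ** diag r ** transpose P" and r: "\<And>i. 0 \<le> r i"
    using psd_spectral_decomposition[OF \<open>psd R\<close>] by blast
  obtain Q s where Q: "orthogonal_matrix Q" "S = Q ** diag s ** transpose Q" and s: "\<And>i. 0 \<le> s i"
    using psd_spectral_decomposition[OF \<open>psd S\<close>] by blast
  note RP = spectral_eigen_equations(2)[OF P] and SQ = spectral_eigen_equations(1)[OF Q]
  define w where "w = transpose P ** W ** Q"
  have "diag r ** (diag r ** w) = diag r ** (diag r ** transpose P) ** W ** Q"
    by (simp only: w_def matrix_mul_assoc)
  also have "\<dots> = (diag r ** transpose P) ** R ** W ** Q"
    by (simp only: RP[symmetric] matrix_mul_assoc)
  also have "\<dots> = transpose P ** ((R ** R) ** W) ** Q"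
    by (simp only: RP[symmetric] matrix_mul_assoc)
  also have "\<dots> = transpose P ** W ** S ** (S ** Q)"
    unfolding eq by (simp only: matrix_mul_assoc)
  also have "\<dots> = transpose P ** W ** S ** (Q ** diag s)"
    by (simp only: SQ)
  also have "\<dots> = transpose P ** W ** (S ** Q) ** diag s"
    by (simp only: matrix_mul_assoc)
  also have "\<dots> = w ** diag s ** diag s"
    unfolding SQ by (simp only: w_def matrix_mul_assoc)
  finally have sq: "diag r ** (diag r ** w) = w ** diag s ** diag s" .
  have "diag r ** w = w ** diag s"
    unfolding vec_eq_iff
  proof (intro allI)
    fix i j
    have "(diag r ** (diag r ** w)) $ i $ j = (w ** diag s ** diag s) $ i $ j"
      by (simp only: sq)
    then have "((r i)\<^sup>2 - (s j)\<^sup>2) * w $ i $ j = 0"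
      by (simp add: power2_eq_square algebra_simps)
    then show "(diag r ** w) $ i $ j = (w ** diag s) $ i $ j"
      using r s by (auto simp: power2_eq_iff_nonneg)
  qed
  then have intertwine: "diag r ** w = w ** diag s" .
  have "(P ** transpose P) ** R ** W ** (Q ** transpose Q) = P ** (transpose P ** R) ** W ** Q ** transpose Q"
    by (simp only: matrix_mul_assoc)
  also have "\<dots> = P ** (diag r ** w) ** transpose Q"
    unfolding RP by (simp only: w_def matrix_mul_assoc)
  also have "\<dots> = P ** transpose P ** W ** (Q ** diag s) ** transpose Q"
    unfolding intertwine by (simp only: w_def matrix_mul_assoc)
  also have "\<dots> = (P ** transpose P) ** W ** S ** (Q ** transpose Q)"
    unfolding SQ[symmetric] by (simp only: matrix_mul_assoc)
  finally have "(P ** transpose P) ** R ** W ** (Q ** transpose Q)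
      = (P ** transpose P) ** W ** S ** (Q ** transpose Q)" .
  then show ?thesis
    by (simp add: orthogonal_matrix_mult_transpose[OF P(1)] orthogonal_matrix_mult_transpose[OF Q(1)])
qed

lemma psd_square_root_unique:
  fixes R S :: "real^'n^'n"
  assumes "psd R" "psd S" "R ** R = S ** S"
  shows "R = S"
  using psd_intertwine_squares[OF assms(1,2), of "mat 1"] assms(3) by simp

lemma psd_square_root_exists:
  fixes A :: "real^'n^'n"
  assumes "psd A"
  shows "\<exists>R. psd R \<and> R ** R = A"
proof -
  obtain Q a where Q: "orthogonal_matrix Q" "A = Q ** diag a ** transpose Q" and a: "\<And>i. 0 \<le> a i"
    using psd_spectral_decomposition[OF \<open>psd A\<close>] by blast
  define R where "R = Q ** diag (\<lambda>i. sqrt (a i)) ** transpose Q"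
  have "psd R"
    using psd_congruence[of "diag (\<lambda>i. sqrt (a i))" "transpose Q"] a by (simp add: R_def psd_diag)
  moreover have "R ** R = Q ** diag (\<lambda>i. sqrt (a i)) ** (transpose Q ** Q) ** diag (\<lambda>i. sqrt (a i)) ** transpose Q"
    unfolding R_def by (simp only: matrix_mul_assoc)
  then have "R ** R = Q ** (diag (\<lambda>i. sqrt (a i)) ** diag (\<lambda>i. sqrt (a i))) ** transpose Q"
    by (simp only: orthogonal_matrix_mult_transpose[OF Q(1)] matrix_mul_rid matrix_mul_assoc)
  then have "R ** R = A"
    using a by (simp add: diag_mult_diag Q(2))
  ultimately show ?thesis by blast
qed

lemma mat_sqrt:
  fixes A :: "real^'n^'n"
  assumes "psd A"
  shows "psd (mat_sqrt A)" "mat_sqrt A ** mat_sqrt A = A"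
proof -
  have "\<exists>!R. psd R \<and> R ** R = A"
    using psd_square_root_exists[OF assms] by (rule ex_ex1I) (auto intro: psd_square_root_unique)
  then have "psd (mat_sqrt A) \<and> mat_sqrt A ** mat_sqrt A = A"
    unfolding mat_sqrt_def by (rule theI')
  then show "psd (mat_sqrt A)" "mat_sqrt A ** mat_sqrt A = A" by auto
qed

lemma mat_sqrt_dg:
  fixes A :: "real^'n^'n"
  assumes "psd A"
  shows "mat_sqrt (dg A) = diag (\<lambda>i. sqrt (A $ i $ i))"
proof -
  have dg: "dg A = diag (\<lambda>i. A $ i $ i)" by (simp add: dg_def diag_def)
  have "psd (dg A)" "psd (diag (\<lambda>i. sqrt (A $ i $ i)))"
    using psd_nth_nonneg[OF assms] by (auto simp: dg psd_diag)
  moreover have "diag (\<lambda>i. sqrt (A $ i $ i)) ** diag (\<lambda>i. sqrt (A $ i $ i)) = dg A"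
    using psd_nth_nonneg[OF assms] by (simp add: diag_mult_diag dg)
  ultimately show ?thesis
    using mat_sqrt[of "dg A"] by (simp add: psd_square_root_unique)
qed

text \<open>
  A matrix and its transpose have the same singular values. With the entries \<open>w\<^sub>i\<^sub>j\<close> of \<open>W\<close> in
  eigenbases of \<open>R\<close> and \<open>S\<close>, the squares in row \<open>i\<close> sum to \<open>r\<^sub>i\<^sup>2\<close>, those in column \<open>j\<close> to \<open>s\<^sub>j\<^sup>2\<close>, and
  \<open>r\<^sub>i = s\<^sub>j\<close> wherever \<open>w\<^sub>i\<^sub>j \<noteq> 0\<close>. Both traces are therefore the double sum of
  \<open>w\<^sub>i\<^sub>j\<^sup>2 / s\<^sub>j = w\<^sub>i\<^sub>j\<^sup>2 / r\<^sub>i\<close>; this handles singular matrices without a polar decomposition.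
\<close>

lemma trace_abs_transpose:
  fixes R S W :: "real^'n^'n"
  assumes "psd R" "psd S" and RR: "R ** R = W ** transpose W" and SS: "S ** S = transpose W ** W"
  shows "trace R = trace S"
proof -
  obtain P r where P: "orthogonal_matrix P" "R = P ** diag r ** transpose P" and r: "\<And>i. 0 \<le> r i"
    using psd_spectral_decomposition[OF \<open>psd R\<close>] by blast
  obtain Q s where Q: "orthogonal_matrix Q" "S = Q ** diag s ** transpose Q" and s: "\<And>i. 0 \<le> s i"
    using psd_spectral_decomposition[OF \<open>psd S\<close>] by blast
  note RP = spectral_eigen_equations[OF P] and SQ = spectral_eigen_equations[OF Q]
  define w where "w = transpose P ** W ** Q"
  have RW: "R ** W = W ** S"
    using assms(1,2) by (rule psd_intertwine_squares) (simp only: RR SS matrix_mul_assoc)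
  have "diag r ** w = (diag r ** transpose P) ** W ** Q"
    by (simp only: w_def matrix_mul_assoc)
  also have "\<dots> = transpose P ** (R ** W) ** Q"
    unfolding RP(2)[symmetric] by (simp only: matrix_mul_assoc)
  also have "\<dots> = transpose P ** W ** (S ** Q)"
    unfolding RW by (simp only: matrix_mul_assoc)
  also have "\<dots> = w ** diag s"
    unfolding SQ(1) by (simp only: w_def matrix_mul_assoc)
  finally have wrs: "diag r ** w = w ** diag s" .
  have "transpose w ** w = transpose Q ** transpose W ** (P ** transpose P) ** W ** Q"
    by (simp only: w_def matrix_transpose_mul transpose_transpose matrix_mul_assoc)
  also have "\<dots> = transpose Q ** (S ** S) ** Q"
    unfolding SS by (simp only: orthogonal_matrix_mult_transpose[OF P(1)] matrix_mul_rid matrix_mul_assoc)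
  also have "\<dots> = (transpose Q ** S) ** (S ** Q)"
    by (simp only: matrix_mul_assoc)
  also have "\<dots> = diag s ** (transpose Q ** Q) ** diag s"
    unfolding SQ(1,2) by (simp only: matrix_mul_assoc)
  finally have wtw: "transpose w ** w = diag s ** diag s"
    by (simp add: orthogonal_matrix_mult_transpose[OF Q(1)])
  have "w ** transpose w = transpose P ** W ** (Q ** transpose Q) ** transpose W ** P"
    by (simp only: w_def matrix_transpose_mul transpose_transpose matrix_mul_assoc)
  also have "\<dots> = transpose P ** (R ** R) ** P"
    unfolding RR by (simp only: orthogonal_matrix_mult_transpose[OF Q(1)] matrix_mul_rid matrix_mul_assoc)
  also have "\<dots> = (transpose P ** R) ** (R ** P)"
    by (simp only: matrix_mul_assoc)
  also have "\<dots> = diag r ** (transpose P ** P) ** diag r"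
    unfolding RP(1,2) by (simp only: matrix_mul_assoc)
  finally have wwt: "w ** transpose w = diag r ** diag r"
    by (simp add: orthogonal_matrix_mult_transpose[OF P(1)])
  have "(transpose w ** w) $ j $ j = s j * s j" for j
    unfolding wtw by simp
  then have cols: "(\<Sum>i\<in>UNIV. (w $ i $ j)\<^sup>2) = s j * s j" for j
    by (simp add: matrix_matrix_mult_def transpose_def power2_eq_square)
  have "(w ** transpose w) $ i $ i = r i * r i" for i
    unfolding wwt by simp
  then have rows: "(\<Sum>j\<in>UNIV. (w $ i $ j)\<^sup>2) = r i * r i" for i
    by (simp add: matrix_matrix_mult_def transpose_def power2_eq_square)
  have quot: "(w $ i $ j)\<^sup>2 / r i = (w $ i $ j)\<^sup>2 / s j" for i j
  proof -
    have "(diag r ** w) $ i $ j = (w ** diag s) $ i $ j"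
      by (simp only: wrs)
    then show ?thesis by (cases "w $ i $ j = 0") auto
  qed
  \<comment> \<open>Zero eigenvalues are harmless: \<open>x * x / x = x\<close> also holds at \<open>x = 0\<close>, where division gives 0.\<close>
  have "trace R = (\<Sum>i\<in>UNIV. (r i * r i) / r i)"
    by (simp add: RP(3))
  also have "\<dots> = (\<Sum>i\<in>UNIV. \<Sum>j\<in>UNIV. (w $ i $ j)\<^sup>2 / s j)"
    by (simp only: rows[symmetric] sum_divide_distrib quot)
  also have "\<dots> = (\<Sum>j\<in>UNIV. (s j * s j) / s j)"
    by (subst sum.swap) (simp only: cols[symmetric] sum_divide_distrib)
  also have "\<dots> = trace S"
    by (simp add: SQ(3))
  finally show ?thesis .
qed

section \<open>Existence of a basis with a common correlation matrix\<close>

text \<open>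
  The entrywise form has no matrix roots left and consists of equations between continuous
  functions of the entries, so that it passes to limits.
\<close>

lemma share_correlation_iff:
  fixes A B :: "real^'n^'n"
  assumes "psd A" "psd B"
  shows "share_correlation A B C \<longleftrightarrow>
    (\<forall>i j. A $ i $ j = sqrt (A $ i $ i) * C $ i $ j * sqrt (A $ j $ j)) \<and>
    (\<forall>i j. B $ i $ j = sqrt (B $ i $ i) * C $ i $ j * sqrt (B $ j $ j))"
  by (simp add: share_correlation_def mat_sqrt_dg assms vec_eq_iff)

text \<open>
  \<open>R\<close> is the root of \<open>A\<close> and \<open>J\<close> its inverse, so \<open>T\<close> is the matrix of the optimal transport map from
  \<open>N(0, A)\<close> to \<open>N(0, B)\<close>. Its eigenvalues must be nonnegative: a negative factor would change the
  sign of correlations.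
\<close>

lemma positive_definite_common_correlation:
  fixes A B :: "real^'n^'n"
  assumes "psd A" "psd B" and pos: "\<And>x. x \<noteq> 0 \<Longrightarrow> 0 < x \<bullet> (A *v x)"
  shows "\<exists>Q C. orthogonal_matrix Q \<and> correlation_matrix C \<and>
    share_correlation (transpose Q ** A ** Q) (transpose Q ** B ** Q) C"
proof -
  define R where "R = mat_sqrt A"
  have R: "psd R" "R ** R = A" unfolding R_def using mat_sqrt[OF \<open>psd A\<close>] by auto
  then have symR: "transpose R = R" by (simp add: psd_def)
  have "x = 0" if "R *v x = 0" for x
  proof -
    have "A *v x = R *v (R *v x)" by (simp add: R(2)[symmetric] matrix_vector_mul_assoc)
    then show ?thesis using pos[of x] that by force
  qed
  then obtain J where J: "J ** R = mat 1"
    using matrix_left_invertible_ker by blast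
  then have RJ: "R ** J = mat 1" by (simp add: matrix_left_right_inverse)
  have "R ** transpose J = mat 1"
    using arg_cong[OF J, of transpose] by (simp add: matrix_transpose_mul symR)
  then have symJ: "transpose J = J"
    by (metis J matrix_mul_assoc matrix_mul_lid matrix_mul_rid)
  define P where "P = mat_sqrt (R ** B ** R)"
  have "psd (R ** B ** R)" using psd_congruence[OF \<open>psd B\<close>, of R] symR by simp
  then have P: "psd P" "P ** P = R ** B ** R" unfolding P_def using mat_sqrt by auto
  define T where "T = J ** P ** J"
  have "psd T" using psd_congruence[OF P(1), of J] by (simp add: T_def symJ)
  have "T ** A ** T = J ** P ** (J ** R) ** (R ** J) ** P ** J"
    by (simp only: T_def R(2)[symmetric] matrix_mul_assoc)
  also have "\<dots> = J ** (P ** P) ** J"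
    by (simp only: J RJ matrix_mul_rid matrix_mul_assoc)
  also have "\<dots> = (J ** R) ** B ** (R ** J)"
    by (simp only: P matrix_mul_assoc)
  finally have TAT: "T ** A ** T = B" by (simp add: J RJ)
  obtain Q t where Q: "orthogonal_matrix Q" "T = Q ** diag t ** transpose Q" and t: "\<And>i. 0 \<le> t i"
    using psd_spectral_decomposition[OF \<open>psd T\<close>] by blast
  define M where "M = transpose Q ** A ** Q"
  define N where "N = transpose Q ** B ** Q"
  have psdMN: "psd M" "psd N"
    unfolding M_def N_def using psd_congruence assms by auto
  have "N = (transpose Q ** T) ** A ** (T ** Q)"
    by (simp only: N_def TAT[symmetric] matrix_mul_assoc)
  then have "N = diag t ** M ** diag t"
    by (simp only: spectral_eigen_equations[OF Q] M_def matrix_mul_assoc)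
  then have N: "N $ i $ j = t i * M $ i $ j * t j" for i j by simp
  have M_pos: "0 < M $ i $ i" for i
  proof -
    have "norm (column i Q) = 1" using Q(1) by (simp add: orthogonal_matrix_orthonormal_columns)
    then have "column i Q \<noteq> 0" by auto
    then show ?thesis unfolding M_def transpose_mult_mult_nth by (rule pos)
  qed
  define D where "D i = 1 / sqrt (M $ i $ i)" for i
  define C where "C = transpose (diag D) ** M ** diag D"
  have C: "C $ i $ j = M $ i $ j / (sqrt (M $ i $ i) * sqrt (M $ j $ j))" for i j
    by (simp add: C_def D_def)
  have "correlation_matrix C"
    unfolding correlation_matrix_def
  proof (intro conjI allI)
    show "psd C" unfolding C_def using psdMN(1) by (rule psd_congruence)
    show "C $ i $ i = 1" for i using M_pos[of i] by (simp add: C)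
  qed
  moreover have M: "M $ i $ j = sqrt (M $ i $ i) * C $ i $ j * sqrt (M $ j $ j)" for i j
    using M_pos[of i] M_pos[of j] by (simp add: C)
  moreover have "sqrt (N $ i $ i) = t i * sqrt (M $ i $ i)" for i
    using t[of i] by (simp add: N real_sqrt_mult)
  then have "N $ i $ j = sqrt (N $ i $ i) * C $ i $ j * sqrt (N $ j $ j)" for i j
    using N[of i j] M[of i j] by (simp add: mult_ac)
  ultimately show ?thesis
    using Q(1) psdMN share_correlation_iff[of M N C] unfolding M_def N_def by blast
qed

lemma tendsto_matrix_mult:
  fixes X :: "'b \<Rightarrow> real^'n^'m" and Y :: "'b \<Rightarrow> real^'p^'n"
  assumes "(X \<longlongrightarrow> A) F" "(Y \<longlongrightarrow> B) F"
  shows "((\<lambda>n. X n ** Y n) \<longlongrightarrow> A ** B) F"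
  unfolding matrix_matrix_mult_def by (intro tendsto_intros assms)

lemma tendsto_matrix_transpose:
  fixes X :: "'b \<Rightarrow> real^'n^'m"
  assumes "(X \<longlongrightarrow> A) F"
  shows "((\<lambda>n. transpose (X n)) \<longlongrightarrow> transpose A) F"
  unfolding transpose_def by (intro tendsto_intros assms)

text \<open>
  Entries bounded by 1 give the compactness of the sets of orthogonal matrices and of correlation
  matrices.
\<close>

lemma bounded_matrices_nth_le_1: "bounded {X :: real^'n^'n. \<forall>i j. \<bar>X $ i $ j\<bar> \<le> 1}"
proof -
  have "norm X \<le> norm ((\<chi> i j. 1) :: real^'n^'n)" if "\<forall>i j. \<bar>X $ i $ j\<bar> \<le> 1" for X :: "real^'n^'n"
    using that by (intro norm_le_componentwise_cart) simp
  then show ?thesis by (auto simp: bounded_iff)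
qed

lemma orthogonal_matrix_nth_le:
  fixes Q :: "real^'n^'n"
  assumes "orthogonal_matrix Q"
  shows "\<bar>Q $ i $ j\<bar> \<le> 1"
proof -
  have "norm (column j Q) = 1" using assms by (simp add: orthogonal_matrix_orthonormal_columns)
  then show ?thesis using component_le_norm_cart[of "column j Q" i] by (simp add: column_def)
qed

text \<open>
  The form of \<open>C\<close> takes the values \<open>2 \<plusminus> 2 C\<^sub>i\<^sub>j\<close> at \<open>e\<^sub>i \<plusminus> e\<^sub>j\<close>.
\<close>

lemma correlation_matrix_nth_le:
  fixes C :: "real^'n^'n"
  assumes "correlation_matrix C"
  shows "\<bar>C $ i $ j\<bar> \<le> 1"
proof -
  have C: "psd C" "\<And>i. C $ i $ i = 1" using assms by (auto simp: correlation_matrix_def)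
  have sym: "C $ j $ i = C $ i $ j"
    using C(1) unfolding psd_def transpose_def by (auto simp: vec_eq_iff)
  have "0 \<le> 2 + 2 * s * C $ i $ j" if "s * s = 1" for s
  proof -
    have "(axis i 1 + s *\<^sub>R axis j 1) \<bullet> (C *v (axis i 1 + s *\<^sub>R axis j 1)) = 2 + 2 * s * C $ i $ j"
      using that C(2) sym
      by (simp add: matrix_vector_right_distrib matrix_vector_mult_scaleR matrix_vector_mult_basis
          inner_add_left inner_add_right inner_axis' column_def algebra_simps)
    then show ?thesis using C(1) unfolding psd_def by metis
  qed
  from this[of 1] this[of "-1"] show ?thesis by simp
qed

text \<open>
  The matrices \<open>A' n = A + I / (n + 1)\<close> are positive definite and tend to \<open>A\<close>. The optimal transport map of the regularised problems may
  blow up in the limit, but the pairs \<open>(Q, C)\<close> stay in a compact set and have a limit point.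
\<close>

lemma common_correlation_exists:
  fixes A B :: "real^'n^'n"
  assumes "psd A" "psd B"
  shows "\<exists>Q C. orthogonal_matrix Q \<and> correlation_matrix C \<and>
    share_correlation (transpose Q ** A ** Q) (transpose Q ** B ** Q) C"
proof -
  define A' where "A' n = A + inverse (real (Suc n)) *\<^sub>R mat 1" for n
  have A'v: "A' n *v x = A *v x + inverse (real (Suc n)) *\<^sub>R x" for n x
    by (simp add: A'_def matrix_vector_mult_add_rdistrib scaleR_matrix_vector_assoc[symmetric])
  have posA': "0 < x \<bullet> (A' n *v x)" if "x \<noteq> 0" for n x
    using assms(1) that unfolding A'v inner_add_right psd_def
    by (simp add: add_nonneg_pos)
  have psdA': "psd (A' n)" for n
  proof -
    have "transpose (A' n) = A' n"
      using assms(1) unfolding psd_def by (auto simp: A'_def vec_eq_iff transpose_def mat_def)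
    then show ?thesis unfolding psd_def using posA' by (metis inner_zero_left less_eq_real_def)
  qed
  have limA': "A' \<longlonglongrightarrow> A"
    using tendsto_add[OF tendsto_const[of A] tendsto_scaleR[OF LIMSEQ_inverse_real_of_nat tendsto_const[of "mat 1 :: real^'n^'n"]]]
    by (simp add: A'_def[abs_def])
  obtain Q C where Q: "\<And>n. orthogonal_matrix (Q n)" and C: "\<And>n. correlation_matrix (C n)"
    and share: "\<And>n. share_correlation (transpose (Q n) ** A' n ** Q n) (transpose (Q n) ** B ** Q n) (C n)"
    using positive_definite_common_correlation[OF psdA' \<open>psd B\<close> posA'] by metis
  have "range (\<lambda>n. (Q n, C n)) \<subseteq> {X. \<forall>i j. \<bar>X $ i $ j\<bar> \<le> 1} \<times> {X. \<forall>i j. \<bar>X $ i $ j\<bar> \<le> 1}"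
    using orthogonal_matrix_nth_le[OF Q] correlation_matrix_nth_le[OF C] by auto
  then have "bounded (range (\<lambda>n. (Q n, C n)))"
    by (rule bounded_subset[OF bounded_Times[OF bounded_matrices_nth_le_1 bounded_matrices_nth_le_1]])
  then have "\<exists>l f. strict_mono (f :: nat \<Rightarrow> nat) \<and> ((\<lambda>n. (Q n, C n)) \<circ> f) \<longlonglongrightarrow> l"
    by (rule bounded_imp_convergent_subsequence)
  then obtain l f where f: "strict_mono (f :: nat \<Rightarrow> nat)" and lim: "((\<lambda>n. (Q n, C n)) \<circ> f) \<longlonglongrightarrow> l"
    by blast
  define Q\<^sub>0 C\<^sub>0 where "Q\<^sub>0 = fst l" and "C\<^sub>0 = snd l"
  have limQ: "(\<lambda>n. Q (f n)) \<longlonglongrightarrow> Q\<^sub>0" and limC: "(\<lambda>n. C (f n)) \<longlonglongrightarrow> C\<^sub>0"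
    using tendsto_fst[OF lim] tendsto_snd[OF lim] by (simp_all add: o_def Q\<^sub>0_def C\<^sub>0_def)
  have limAf: "(\<lambda>n. A' (f n)) \<longlonglongrightarrow> A"
    using LIMSEQ_subseq_LIMSEQ[OF limA' f] by (simp add: o_def)
  have "(\<lambda>n. transpose (Q (f n)) ** Q (f n)) \<longlonglongrightarrow> transpose Q\<^sub>0 ** Q\<^sub>0"
    by (intro tendsto_matrix_mult tendsto_matrix_transpose limQ)
  then have orth: "orthogonal_matrix Q\<^sub>0"
    by (simp add: orthogonal_matrix_mult_transpose[OF Q] orthogonal_matrix LIMSEQ_const_iff)
  have psdC: "psd (C n)" and diagC: "C n $ i $ i = 1" for n i
    using C by (auto simp: correlation_matrix_def)
  have "(\<lambda>n. transpose (C (f n))) \<longlonglongrightarrow> transpose C\<^sub>0"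
    by (intro tendsto_matrix_transpose limC)
  then have "(\<lambda>n. C (f n)) \<longlonglongrightarrow> transpose C\<^sub>0"
    using psdC by (simp add: psd_def)
  then have "transpose C\<^sub>0 = C\<^sub>0" using limC LIMSEQ_unique by blast
  moreover have "0 \<le> x \<bullet> (C\<^sub>0 *v x)" for x
  proof (rule LIMSEQ_le_const)
    show "(\<lambda>n. x \<bullet> (C (f n) *v x)) \<longlonglongrightarrow> x \<bullet> (C\<^sub>0 *v x)"
      unfolding matrix_vector_mult_def by (intro tendsto_intros limC)
    show "\<exists>N. \<forall>n\<ge>N. 0 \<le> x \<bullet> (C (f n) *v x)" using psdC by (simp add: psd_def)
  qed
  moreover have "C\<^sub>0 $ i $ i = 1" for i
    using tendsto_vec_nth[OF tendsto_vec_nth[OF limC, of i], of i] by (simp add: diagC LIMSEQ_const_iff)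
  ultimately have corr: "correlation_matrix C\<^sub>0" by (simp add: correlation_matrix_def psd_def)
  have limit_identity: "M\<^sub>0 $ i $ j = sqrt (M\<^sub>0 $ i $ i) * C\<^sub>0 $ i $ j * sqrt (M\<^sub>0 $ j $ j)"
    if "M \<longlonglongrightarrow> M\<^sub>0" "\<And>n i j. M n $ i $ j = sqrt (M n $ i $ i) * C (f n) $ i $ j * sqrt (M n $ j $ j)"
    for M :: "nat \<Rightarrow> real^'n^'n" and M\<^sub>0 i j
  proof (rule LIMSEQ_unique)
    show "(\<lambda>n. M n $ i $ j) \<longlonglongrightarrow> M\<^sub>0 $ i $ j"
      by (intro tendsto_intros that)
    show "(\<lambda>n. M n $ i $ j) \<longlonglongrightarrow> sqrt (M\<^sub>0 $ i $ i) * C\<^sub>0 $ i $ j * sqrt (M\<^sub>0 $ j $ j)"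
      by (subst that(2)) (intro tendsto_intros that(1) limC)
  qed
  have "share_correlation (transpose Q\<^sub>0 ** A ** Q\<^sub>0) (transpose Q\<^sub>0 ** B ** Q\<^sub>0) C\<^sub>0"
    unfolding share_correlation_iff[OF psd_congruence[OF assms(1)] psd_congruence[OF assms(2)]]
  proof (intro conjI allI)
    fix i j
    note sh = share[unfolded share_correlation_iff[OF psd_congruence[OF psdA'] psd_congruence[OF assms(2)]]]
    show "(transpose Q\<^sub>0 ** A ** Q\<^sub>0) $ i $ j = sqrt ((transpose Q\<^sub>0 ** A ** Q\<^sub>0) $ i $ i) * C\<^sub>0 $ i $ j * sqrt ((transpose Q\<^sub>0 ** A ** Q\<^sub>0) $ j $ j)"
    proof (rule limit_identity)
      show "(\<lambda>n. transpose (Q (f n)) ** A' (f n) ** Q (f n)) \<longlonglongrightarrow> transpose Q\<^sub>0 ** A ** Q\<^sub>0"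
        by (intro tendsto_matrix_mult tendsto_matrix_transpose limQ limAf)
    qed (use sh in blast)
    show "(transpose Q\<^sub>0 ** B ** Q\<^sub>0) $ i $ j = sqrt ((transpose Q\<^sub>0 ** B ** Q\<^sub>0) $ i $ i) * C\<^sub>0 $ i $ j * sqrt ((transpose Q\<^sub>0 ** B ** Q\<^sub>0) $ j $ j)"
    proof (rule limit_identity)
      show "(\<lambda>n. transpose (Q (f n)) ** B ** Q (f n)) \<longlonglongrightarrow> transpose Q\<^sub>0 ** B ** Q\<^sub>0"
        by (intro tendsto_matrix_mult tendsto_matrix_transpose limQ tendsto_const)
    qed (use sh in blast)
  qed
  with orth corr show ?thesis by blast
qed

section \<open>Couplings as positive semi-definite block matrices\<close>

lemma sum_UNIV_sum_type:
  fixes f :: "'a::finite + 'b::finite \<Rightarrow> 'c::comm_monoid_add"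
  shows "sum f UNIV = (\<Sum>a\<in>UNIV. f (Inl a)) + (\<Sum>b\<in>UNIV. f (Inr b))"
  unfolding UNIV_Plus_UNIV[symmetric] by (subst sum.Plus) (simp_all add: o_def)

lemma block_cov_quadratic_form:
  fixes A B T :: "real^'n^'n" and x :: "real^('n + 'n)"
  defines "u \<equiv> \<chi> i. x $ Inl i" and "v \<equiv> \<chi> i. x $ Inr i"
  shows "x \<bullet> (block_cov A B T *v x) = u \<bullet> (A *v u) + 2 * (u \<bullet> (T *v v)) + v \<bullet> (B *v v)"
proof -
  have "x \<bullet> (block_cov A B T *v x)
      = u \<bullet> (A *v u) + u \<bullet> (T *v v) + v \<bullet> (transpose T *v u) + v \<bullet> (B *v v)"
    by (simp add: inner_vec_def matrix_vector_mult_def block_cov_def sum_UNIV_sum_type u_def v_def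
        distrib_left sum.distrib add_ac del: transpose_matrix_vector)
  moreover have "v \<bullet> (transpose T *v u) = u \<bullet> (T *v v)"
    by (simp add: inner_commute[of v] dot_lmul_matrix)
  ultimately show ?thesis by simp
qed

lemma psd_block_cov_iff:
  fixes A B T :: "real^'n^'n"
  assumes "psd A" "psd B"
  shows "psd (block_cov A B T) \<longleftrightarrow>
    (\<forall>u v. 0 \<le> u \<bullet> (A *v u) + 2 * (u \<bullet> (T *v v)) + v \<bullet> (B *v v))"
proof
  assume *: "psd (block_cov A B T)"
  show "\<forall>u v. 0 \<le> u \<bullet> (A *v u) + 2 * (u \<bullet> (T *v v)) + v \<bullet> (B *v v)"
  proof (intro allI)
    fix u v :: "real^'n"
    define x :: "real^('n + 'n)" where "x = (\<chi> k. case k of Inl i \<Rightarrow> u $ i | Inr i \<Rightarrow> v $ i)"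
    have "0 \<le> x \<bullet> (block_cov A B T *v x)" using * by (simp add: psd_def)
    then show "0 \<le> u \<bullet> (A *v u) + 2 * (u \<bullet> (T *v v)) + v \<bullet> (B *v v)"
      unfolding block_cov_quadratic_form by (simp add: x_def)
  qed
next
  assume *: "\<forall>u v. 0 \<le> u \<bullet> (A *v u) + 2 * (u \<bullet> (T *v v)) + v \<bullet> (B *v v)"
  have "A $ i $ j = A $ j $ i" "B $ i $ j = B $ j $ i" for i j
    using assms unfolding psd_def transpose_def vec_eq_iff by auto
  then have "transpose (block_cov A B T) = block_cov A B T"
    by (auto simp: vec_eq_iff transpose_def block_cov_def split: sum.split)
  then show "psd (block_cov A B T)"
    using * by (simp add: psd_def block_cov_quadratic_form)
qed

text \<open>
  The determinant of a nonnegative binary form is nonnegative. If \<open>\<tau>\<^sup>2 > \<alpha> \<beta>\<close>, the vectors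
  \<open>(\<tau>, \<alpha>)\<close> and \<open>(\<beta>, \<tau>)\<close> force \<open>\<alpha> = \<beta> = 0\<close>, and then \<open>(1, 1)\<close> gives \<open>\<tau> \<le> 0\<close>.
\<close>

lemma cross_term_le_geometric_mean:
  fixes \<alpha> \<beta> \<tau> :: real
  assumes "0 \<le> \<alpha>" "0 \<le> \<beta>" and form: "\<And>s t. 0 \<le> s\<^sup>2 * \<alpha> - 2 * s * t * \<tau> + t\<^sup>2 * \<beta>"
  shows "\<tau> \<le> sqrt (\<alpha> * \<beta>)"
proof (rule ccontr)
  assume "\<not> \<tau> \<le> sqrt (\<alpha> * \<beta>)"
  then have lt: "sqrt (\<alpha> * \<beta>) < \<tau>" by simp
  have "0 \<le> sqrt (\<alpha> * \<beta>)" using assms by simp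
  then have \<tau>: "0 < \<tau>" using lt by linarith
  have "(sqrt (\<alpha> * \<beta>))\<^sup>2 < \<tau>\<^sup>2"
    using lt assms by (intro power_strict_mono) auto
  then have neg: "\<alpha> * \<beta> - \<tau>\<^sup>2 < 0" using assms by simp
  have "0 \<le> \<alpha> * (\<alpha> * \<beta> - \<tau>\<^sup>2)" "0 \<le> \<beta> * (\<alpha> * \<beta> - \<tau>\<^sup>2)"
    using form[of \<tau> \<alpha>] form[of \<beta> \<tau>] by (simp_all add: algebra_simps power2_eq_square)
  then have "\<alpha> = 0" "\<beta> = 0"
    using neg assms(1,2) unfolding zero_le_mult_iff by linarith+
  then show False using form[of 1 1] \<tau> by simp
qed

lemma trace_orthogonal_conjugate:
  fixes Q T :: "real^'n^'n"
  assumes "orthogonal_matrix Q"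
  shows "trace (transpose Q ** T ** Q) = trace T"
proof -
  have "trace (transpose Q ** T ** Q) = trace ((Q ** transpose Q) ** T)"
    by (subst trace_mul_sym) (simp only: matrix_mul_assoc)
  then show ?thesis by (simp add: orthogonal_matrix_mult_transpose[OF assms])
qed

text \<open>
  Restricting the block form to the plane spanned by \<open>(q, 0)\<close> and \<open>(0, q)\<close>, for a column \<open>q\<close> of
  \<open>Q\<close>, bounds each diagonal entry of \<open>T\<close> in the basis \<open>Q\<close>.
\<close>

lemma trace_coupling_le:
  fixes A B T Q :: "real^'n^'n"
  assumes "psd A" "psd B" "orthogonal_matrix Q" "psd (block_cov A B T)"
  shows "trace T \<le> (\<Sum>i\<in>UNIV. sqrt ((transpose Q ** A ** Q) $ i $ i * (transpose Q ** B ** Q) $ i $ i))"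
proof -
  have "(transpose Q ** T ** Q) $ i $ i
      \<le> sqrt ((transpose Q ** A ** Q) $ i $ i * (transpose Q ** B ** Q) $ i $ i)" for i
  proof (rule cross_term_le_geometric_mean)
    show "0 \<le> (transpose Q ** A ** Q) $ i $ i" "0 \<le> (transpose Q ** B ** Q) $ i $ i"
      using assms by (auto intro: psd_nth_nonneg psd_congruence)
    fix s t :: real
    let ?q = "column i Q"
    have "0 \<le> (s *\<^sub>R ?q) \<bullet> (A *v (s *\<^sub>R ?q)) + 2 * ((s *\<^sub>R ?q) \<bullet> (T *v (- t *\<^sub>R ?q)))
        + (- t *\<^sub>R ?q) \<bullet> (B *v (- t *\<^sub>R ?q))"
      using assms psd_block_cov_iff by blast
    then show "0 \<le> s\<^sup>2 * (transpose Q ** A ** Q) $ i $ i - 2 * s * t * (transpose Q ** T ** Q) $ i $ i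
        + t\<^sup>2 * (transpose Q ** B ** Q) $ i $ i"
      unfolding transpose_mult_mult_nth matrix_vector_mult_scaleR
      by (simp add: power2_eq_square mult_ac)
  qed
  then have "trace (transpose Q ** T ** Q)
      \<le> (\<Sum>i\<in>UNIV. sqrt ((transpose Q ** A ** Q) $ i $ i * (transpose Q ** B ** Q) $ i $ i))"
    unfolding trace_def by (rule sum_mono)
  then show ?thesis by (simp add: trace_orthogonal_conjugate assms)
qed

lemma inner_factored_form:
  fixes Q C :: "real^'n^'n"
  shows "u \<bullet> ((Q ** diag a ** C ** diag b ** transpose Q) *v v)
    = (diag a *v (transpose Q *v u)) \<bullet> (C *v (diag b *v (transpose Q *v v)))"
proof -
  have move: "x \<bullet> (X *v y) = (transpose X *v x) \<bullet> y" for X :: "real^'n^'n" and x y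
    by (simp add: dot_lmul_matrix)
  show ?thesis
    by (simp only: matrix_vector_mul_assoc[symmetric] move[of _ Q] move[of _ "diag a"] transpose_diag)
qed

text \<open>
  With \<open>x = diag a Q\<^sup>T u\<close> and \<open>y = diag b Q\<^sup>T v\<close>, the block form at \<open>(u, v)\<close> is the form of \<open>C\<close> at
  \<open>x + y\<close>.
\<close>

lemma diag_congruence_block_cov:
  fixes Q C :: "real^'n^'n"
  assumes "psd C" and A: "A = Q ** diag a ** C ** diag a ** transpose Q"
    and B: "B = Q ** diag b ** C ** diag b ** transpose Q"
    and "psd A" "psd B"
  shows "psd (block_cov A B (Q ** diag a ** C ** diag b ** transpose Q))"
proof -
  have "0 \<le> u \<bullet> (A *v u) + 2 * (u \<bullet> ((Q ** diag a ** C ** diag b ** transpose Q) *v v)) + v \<bullet> (B *v v)"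
    for u v
  proof -
    define x where "x = diag a *v (transpose Q *v u)"
    define y where "y = diag b *v (transpose Q *v v)"
    have "y \<bullet> (C *v x) = x \<bullet> (C *v y)"
      using symmetric_inner[of C x y] \<open>psd C\<close> by (simp add: psd_def inner_commute)
    then have "x \<bullet> (C *v x) + 2 * (x \<bullet> (C *v y)) + y \<bullet> (C *v y) = (x + y) \<bullet> (C *v (x + y))"
      by (simp add: matrix_vector_right_distrib inner_add_left inner_add_right)
    then show ?thesis
      unfolding A B inner_factored_form x_def[symmetric] y_def[symmetric]
      using \<open>psd C\<close> by (simp add: psd_def)
  qed
  then show ?thesis using psd_block_cov_iff[OF \<open>psd A\<close> \<open>psd B\<close>] by blast
qed

section \<open>The value of the maximization problem\<close>

text \<open>
  The two Gram matrices of \<open>W = C\<^sup>1\<^sup>/\<^sup>2 diag b Q\<^sup>T A\<^sup>1\<^sup>/\<^sup>2\<close> are the matrix under the root, and a matrix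
  whose root is visibly \<open>C\<^sup>1\<^sup>/\<^sup>2 diag (a b) C\<^sup>1\<^sup>/\<^sup>2\<close>.
\<close>

lemma trace_mat_sqrt_common_correlation:
  fixes A B Q C :: "real^'n^'n"
  assumes "psd A" "psd B" "correlation_matrix C"
    and a: "\<And>i. 0 \<le> a i" and b: "\<And>i. 0 \<le> b i"
    and A: "transpose Q ** A ** Q = diag a ** C ** diag a"
    and B: "B = Q ** diag b ** C ** diag b ** transpose Q"
  shows "trace (mat_sqrt (mat_sqrt A ** B ** mat_sqrt A)) = (\<Sum>i\<in>UNIV. a i * b i)"
proof -
  have C: "psd C" "\<And>i. C $ i $ i = 1" using assms(3) by (auto simp: correlation_matrix_def)
  define G where "G = mat_sqrt C"
  have G: "psd G" "G ** G = C" unfolding G_def using mat_sqrt[OF C(1)] by auto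
  then have symG: "transpose G = G" by (simp add: psd_def)
  define R where "R = mat_sqrt A"
  have R: "psd R" "R ** R = A" unfolding R_def using mat_sqrt[OF \<open>psd A\<close>] by auto
  then have symR: "transpose R = R" by (simp add: psd_def)
  have "psd (R ** B ** R)" using psd_congruence[OF \<open>psd B\<close>, of R] symR by simp
  note S = mat_sqrt[OF this]
  define W where "W = G ** diag b ** transpose Q ** R"
  have tW: "transpose W = R ** Q ** diag b ** G"
    by (simp only: W_def matrix_transpose_mul symG symR transpose_transpose transpose_diag matrix_mul_assoc)
  have tWW: "transpose W ** W = R ** B ** R"
    unfolding tW unfolding W_def B G(2)[symmetric] by (simp only: matrix_mul_assoc)
  have "W ** transpose W = G ** diag b ** (transpose Q ** (R ** R) ** Q) ** diag b ** G"
    unfolding tW unfolding W_def by (simp only: matrix_mul_assoc)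
  also have "\<dots> = G ** (diag b ** diag a) ** G ** G ** (diag a ** diag b) ** G"
    unfolding R(2) A G(2)[symmetric] by (simp only: matrix_mul_assoc)
  finally have WtW: "W ** transpose W = (G ** diag (\<lambda>i. a i * b i) ** G) ** (G ** diag (\<lambda>i. a i * b i) ** G)"
    unfolding diag_mult_diag by (simp only: matrix_mul_assoc mult.commute)
  have "psd (G ** diag (\<lambda>i. a i * b i) ** G)"
    using psd_congruence[of "diag (\<lambda>i. a i * b i)" G] a b symG by (simp add: psd_diag)
  then have "trace (G ** diag (\<lambda>i. a i * b i) ** G) = trace (mat_sqrt (R ** B ** R))"
    using S(1) by (rule trace_abs_transpose[where W = W]) (simp_all only: WtW S(2) tWW)
  moreover have "trace (G ** diag (\<lambda>i. a i * b i) ** G) = trace (C ** diag (\<lambda>i. a i * b i))"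
    by (subst trace_mul_sym) (simp only: matrix_mul_assoc G(2))
  moreover have "trace (C ** diag (\<lambda>i. a i * b i)) = (\<Sum>i\<in>UNIV. a i * b i)"
    by (simp add: trace_def C(2))
  ultimately show ?thesis by (simp add: R_def)
qed

theorem theorem2:
  fixes \<Sigma>\<^sub>\<mu> \<Sigma>\<^sub>\<nu> :: "real^'d^'d"
  assumes "psd \<Sigma>\<^sub>\<mu>" and "psd \<Sigma>\<^sub>\<nu>"
  shows "(\<exists>Q C. orthogonal_matrix Q \<and> correlation_matrix C \<and>
            share_correlation (transpose Q ** \<Sigma>\<^sub>\<mu> ** Q) (transpose Q ** \<Sigma>\<^sub>\<nu> ** Q) C) \<and>
         (\<forall>Q C. orthogonal_matrix Q \<and> correlation_matrix C \<and>
            share_correlation (transpose Q ** \<Sigma>\<^sub>\<mu> ** Q) (transpose Q ** \<Sigma>\<^sub>\<nu> ** Q) C \<longrightarrow>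
            (let M = transpose Q ** \<Sigma>\<^sub>\<mu> ** Q;
                 N = transpose Q ** \<Sigma>\<^sub>\<nu> ** Q;
                 \<Theta> = Q ** mat_sqrt (dg M) ** C ** mat_sqrt (dg N) ** transpose Q
             in optimal_coupling \<Sigma>\<^sub>\<mu> \<Sigma>\<^sub>\<nu> \<Theta> \<and>
                V \<Sigma>\<^sub>\<mu> \<Sigma>\<^sub>\<nu> = ereal (trace \<Theta>) \<and>
                trace \<Theta> = (\<Sum>i\<in>UNIV. sqrt (M $ i $ i * N $ i $ i)) \<and>
                (\<Sum>i\<in>UNIV. sqrt (M $ i $ i * N $ i $ i)) =
                  trace (mat_sqrt (mat_sqrt \<Sigma>\<^sub>\<mu> ** \<Sigma>\<^sub>\<nu> ** mat_sqrt \<Sigma>\<^sub>\<mu>))))"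
proof (intro conjI allI impI)
  show "\<exists>Q C. orthogonal_matrix Q \<and> correlation_matrix C \<and>
      share_correlation (transpose Q ** \<Sigma>\<^sub>\<mu> ** Q) (transpose Q ** \<Sigma>\<^sub>\<nu> ** Q) C"
    using assms by (rule common_correlation_exists)
next
  fix Q C :: "real^'d^'d"
  assume "orthogonal_matrix Q \<and> correlation_matrix C \<and>
      share_correlation (transpose Q ** \<Sigma>\<^sub>\<mu> ** Q) (transpose Q ** \<Sigma>\<^sub>\<nu> ** Q) C"
  then have Q: "orthogonal_matrix Q" and C: "correlation_matrix C"
    and share: "share_correlation (transpose Q ** \<Sigma>\<^sub>\<mu> ** Q) (transpose Q ** \<Sigma>\<^sub>\<nu> ** Q) C" by auto
  define M where "M = transpose Q ** \<Sigma>\<^sub>\<mu> ** Q"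
  define N where "N = transpose Q ** \<Sigma>\<^sub>\<nu> ** Q"
  define a where "a i = sqrt (M $ i $ i)" for i
  define b where "b i = sqrt (N $ i $ i)" for i
  define \<Theta> where "\<Theta> = Q ** mat_sqrt (dg M) ** C ** mat_sqrt (dg N) ** transpose Q"
  have psdMN: "psd M" "psd N"
    unfolding M_def N_def using assms psd_congruence by auto
  have ab: "0 \<le> a i" "0 \<le> b i" for i
    using psd_nth_nonneg[OF psdMN(1)] psd_nth_nonneg[OF psdMN(2)] by (auto simp: a_def b_def)
  have sqrt_dg: "mat_sqrt (dg M) = diag a" "mat_sqrt (dg N) = diag b"
    by (simp_all add: mat_sqrt_dg psdMN a_def[abs_def] b_def[abs_def])
  have M: "M = diag a ** C ** diag a" and N: "N = diag b ** C ** diag b"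
    using share unfolding M_def[symmetric] N_def[symmetric] share_correlation_def sqrt_dg by auto
  have conj_back: "Q ** (transpose Q ** X ** Q) ** transpose Q = X" for X
  proof -
    have "Q ** (transpose Q ** X ** Q) ** transpose Q = (Q ** transpose Q) ** X ** (Q ** transpose Q)"
      by (simp only: matrix_mul_assoc)
    then show ?thesis by (simp add: orthogonal_matrix_mult_transpose[OF Q])
  qed
  have \<mu>: "\<Sigma>\<^sub>\<mu> = Q ** diag a ** C ** diag a ** transpose Q"
    using conj_back[of \<Sigma>\<^sub>\<mu>] unfolding M_def[symmetric] M by (simp only: matrix_mul_assoc)
  have \<nu>: "\<Sigma>\<^sub>\<nu> = Q ** diag b ** C ** diag b ** transpose Q"
    using conj_back[of \<Sigma>\<^sub>\<nu>] unfolding N_def[symmetric] N by (simp only: matrix_mul_assoc)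
  have \<Theta>: "\<Theta> = Q ** diag a ** C ** diag b ** transpose Q"
    by (simp only: \<Theta>_def sqrt_dg)
  have feasible: "psd (block_cov \<Sigma>\<^sub>\<mu> \<Sigma>\<^sub>\<nu> \<Theta>)"
    unfolding \<Theta> using C \<mu> \<nu> assms
    by (intro diag_congruence_block_cov) (auto simp: correlation_matrix_def)
  have "trace \<Theta> = trace ((transpose Q ** Q) ** (diag a ** C ** diag b))"
    unfolding \<Theta> by (subst trace_mul_sym) (simp only: matrix_mul_assoc)
  also have "\<dots> = (\<Sum>i\<in>UNIV. a i * b i)"
    using C by (simp add: orthogonal_matrix_mult_transpose[OF Q] trace_def correlation_matrix_def)
  finally have trace_ab: "trace \<Theta> = (\<Sum>i\<in>UNIV. a i * b i)" .
  then have trace_sqrt: "trace \<Theta> = (\<Sum>i\<in>UNIV. sqrt (M $ i $ i * N $ i $ i))"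
    by (simp add: a_def b_def real_sqrt_mult)
  have V_eq: "V \<Sigma>\<^sub>\<mu> \<Sigma>\<^sub>\<nu> = ereal (trace \<Theta>)"
  proof (rule antisym)
    show "V \<Sigma>\<^sub>\<mu> \<Sigma>\<^sub>\<nu> \<le> ereal (trace \<Theta>)"
      unfolding V_def trace_sqrt M_def N_def
      using trace_coupling_le[OF assms Q] by (intro SUP_least) simp
    show "ereal (trace \<Theta>) \<le> V \<Sigma>\<^sub>\<mu> \<Sigma>\<^sub>\<nu>"
      unfolding V_def using feasible by (intro SUP_upper) simp
  qed
  have "trace (mat_sqrt (mat_sqrt \<Sigma>\<^sub>\<mu> ** \<Sigma>\<^sub>\<nu> ** mat_sqrt \<Sigma>\<^sub>\<mu>)) = (\<Sum>i\<in>UNIV. a i * b i)"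
    using assms C ab M[unfolded M_def] \<nu> by (rule trace_mat_sqrt_common_correlation)
  then have "(\<Sum>i\<in>UNIV. sqrt (M $ i $ i * N $ i $ i))
      = trace (mat_sqrt (mat_sqrt \<Sigma>\<^sub>\<mu> ** \<Sigma>\<^sub>\<nu> ** mat_sqrt \<Sigma>\<^sub>\<mu>))"
    using trace_ab trace_sqrt by simp
  with feasible V_eq trace_sqrt
  show "let M = transpose Q ** \<Sigma>\<^sub>\<mu> ** Q;
            N = transpose Q ** \<Sigma>\<^sub>\<nu> ** Q;
            \<Theta> = Q ** mat_sqrt (dg M) ** C ** mat_sqrt (dg N) ** transpose Q
        in optimal_coupling \<Sigma>\<^sub>\<mu> \<Sigma>\<^sub>\<nu> \<Theta> \<and>
           V \<Sigma>\<^sub>\<mu> \<Sigma>\<^sub>\<nu> = ereal (trace \<Theta>) \<and>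
           trace \<Theta> = (\<Sum>i\<in>UNIV. sqrt (M $ i $ i * N $ i $ i)) \<and>
           (\<Sum>i\<in>UNIV. sqrt (M $ i $ i * N $ i $ i)) =
             trace (mat_sqrt (mat_sqrt \<Sigma>\<^sub>\<mu> ** \<Sigma>\<^sub>\<nu> ** mat_sqrt \<Sigma>\<^sub>\<mu>))"
    unfolding Let_def M_def[symmetric] N_def[symmetric] \<Theta>_def[symmetric] optimal_coupling_def
    by simp
qed

end
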